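(* Let $E$ be a directed graph and $K$ a field. Assume that every Lie ideal of $L_K(E)$ is an ideal of $L_K(E)$. Then $L_K(E)$ is a locally finite $K$-algebra. In particular, the Lie algebra $L_K(E)^-$ is locally finite as a Lie algebra over $K$.
   Context: A directed graph $E=(E^0,E^1,r,s)$ consists of sets $E^0$ (vertices), $E^1$ (edges), of arbitrary cardinality, and maps $r,s:E^1\to E^0$ (range, source). A vertex is regular if it emits at least one and only finitely many edges; $\mathrm{Reg}(E)$ is the set of regular vertices. The Leavitt path algebra $L_K(E)$ is the associative (not necessarily unital) $K$-algebra generated by $E^0\cup E^1\cup\{e^*: e\in E^1\}$ subject to: $vv'=\delta_{v,v'}v$ for $v,v'\in E^0$; $s(e)e=er(e)=e$ and $r(e)e^*=e^*s(e)=e^*$ for $e\in E^1$; $e^*f=\delta_{e,f}r(e)$ for $e,f\in E^1$; $v=\sum_{s(e)=v}ee^*$ for $v\in\mathrm{Reg}(E)$. "Ideal" means two-sided ring-theoretic ideal. For an associative $K$-algebra $A$, $A^-$ is the Lie algebra on $A$ with $[a,b]=ab-ba$; a Lie ideal of $A$ is a $K$-subspace $U$ with $[U,A]\subseteq U$. An associative $K$-algebra $A$ is a locally finite $K$-algebra if every finite subset of $A$ is contained in a finite-dimensional (not necessarily unital) $K$-subalgebra. A Lie algebra is locally finite if every finite subset is contained in a finite-dimensional Lie subalgebra. *)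

theory Defs
  imports "HOL-Library.Poly_Mapping" "Graph_Theory.Digraph"
begin

section \<open>Not necessarily unital or associative algebras over a field\<close>

text \<open>The library's records for rings and algebras presuppose a unit.  The following
  signature is used both for associative algebras and for Lie algebras.\<close>

record ('k, 'a) algebra =
  elems :: "'a set"
  zeroA :: 'a
  addA :: "'a \<Rightarrow> 'a \<Rightarrow> 'a"
  mulA :: "'a \<Rightarrow> 'a \<Rightarrow> 'a"
  scaleA :: "'k \<Rightarrow> 'a \<Rightarrow> 'a"

definition diffA :: "('k::field, 'a) algebra \<Rightarrow> 'a \<Rightarrow> 'a \<Rightarrow> 'a" where
  "diffA A a b = addA A a (scaleA A (- 1) b)"

definition commutator :: "('k::field, 'a) algebra \<Rightarrow> 'a \<Rightarrow> 'a \<Rightarrow> 'a" where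
  "commutator A a b = diffA A (mulA A a b) (mulA A b a)"

definition lie_algebra_of :: "('k::field, 'a) algebra \<Rightarrow> ('k, 'a) algebra" where
  "lie_algebra_of A = A\<lparr>mulA := commutator A\<rparr>"

definition linear_subspace :: "('k::field, 'a) algebra \<Rightarrow> 'a set \<Rightarrow> bool" where
  "linear_subspace A U \<longleftrightarrow> U \<subseteq> elems A \<and> zeroA A \<in> U \<and>
     (\<forall>x\<in>U. \<forall>y\<in>U. addA A x y \<in> U) \<and> (\<forall>c. \<forall>x\<in>U. scaleA A c x \<in> U)"

definition linear_span :: "('k::field, 'a) algebra \<Rightarrow> 'a set \<Rightarrow> 'a set" where
  "linear_span A T = linear_subspace A hull T"

definition finite_dimensional :: "('k::field, 'a) algebra \<Rightarrow> 'a set \<Rightarrow> bool" where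
  "finite_dimensional A U \<longleftrightarrow> (\<exists>T. finite T \<and> T \<subseteq> elems A \<and> linear_span A T = U)"

definition subalgebra :: "('k::field, 'a) algebra \<Rightarrow> 'a set \<Rightarrow> bool" where
  "subalgebra A B \<longleftrightarrow> linear_subspace A B \<and> (\<forall>x\<in>B. \<forall>y\<in>B. mulA A x y \<in> B)"

text \<open>Applied to \<^term>\<open>lie_algebra_of A\<close>, the next notion is local finiteness as a Lie algebra,
  since the multiplication is then the Lie bracket.\<close>

definition locally_finite :: "('k::field, 'a) algebra \<Rightarrow> bool" where
  "locally_finite A \<longleftrightarrow> (\<forall>S. finite S \<and> S \<subseteq> elems A \<longrightarrow>
     (\<exists>B. subalgebra A B \<and> finite_dimensional A B \<and> S \<subseteq> B))"

definition lie_ideal :: "('k::field, 'a) algebra \<Rightarrow> 'a set \<Rightarrow> bool" where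
  "lie_ideal A U \<longleftrightarrow> linear_subspace A U \<and> (\<forall>u\<in>U. \<forall>a\<in>elems A. commutator A u a \<in> U)"

definition absorbs :: "('k, 'a) algebra \<Rightarrow> 'a set \<Rightarrow> bool" where
  "absorbs A I \<longleftrightarrow> (\<forall>x\<in>I. \<forall>a\<in>elems A. mulA A x a \<in> I \<and> mulA A a x \<in> I)"

text \<open>A ring-theoretic ideal is only required to be an additive subgroup; without a unit it
  need not be closed under scalars.  Presenting an algebra by generators and relations needs
  ideals that are subspaces.\<close>

definition ring_ideal :: "('k::field, 'a) algebra \<Rightarrow> 'a set \<Rightarrow> bool" where
  "ring_ideal A I \<longleftrightarrow> I \<subseteq> elems A \<and> zeroA A \<in> I \<and> (\<forall>x\<in>I. \<forall>y\<in>I. diffA A x y \<in> I) \<and> absorbs A I"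

definition algebra_ideal :: "('k::field, 'a) algebra \<Rightarrow> 'a set \<Rightarrow> bool" where
  "algebra_ideal A I \<longleftrightarrow> linear_subspace A I \<and> absorbs A I"

definition coset :: "('k, 'a) algebra \<Rightarrow> 'a set \<Rightarrow> 'a \<Rightarrow> 'a set" where
  "coset A I a = addA A a ` I"

definition quotient_algebra :: "('k, 'a) algebra \<Rightarrow> 'a set \<Rightarrow> ('k, 'a set) algebra" where
  "quotient_algebra A I = \<lparr>
     elems = coset A I ` elems A,
     zeroA = coset A I (zeroA A),
     addA = (\<lambda>X Y. \<Union>x\<in>X. \<Union>y\<in>Y. coset A I (addA A x y)),
     mulA = (\<lambda>X Y. \<Union>x\<in>X. \<Union>y\<in>Y. coset A I (mulA A x y)),
     scaleA = (\<lambda>c X. \<Union>x\<in>X. coset A I (scaleA A c x))\<rparr>"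


section \<open>Free non-unital associative algebras\<close>

datatype 'g word = Word (letters: "'g list")

instantiation word :: (type) monoid_add
begin

definition zero_word :: "'a word" where
  "0 = Word []"

definition plus_word :: "'a word \<Rightarrow> 'a word \<Rightarrow> 'a word" where
  "v + w = Word (letters v @ letters w)"

instance
  by standard (simp_all add: zero_word_def plus_word_def)

end

text \<open>With this instance, \<^typ>\<open>'g word \<Rightarrow>\<^sub>0 'k\<close> is the unital ring of noncommutative polynomials;
  excluding the empty word gives the free non-unital algebra.\<close>

definition free_algebra :: "'g set \<Rightarrow> ('k::field, 'g word \<Rightarrow>\<^sub>0 'k) algebra" where
  "free_algebra G = \<lparr>
     elems = {p. \<forall>w \<in> Poly_Mapping.keys p. letters w \<noteq> [] \<and> set (letters w) \<subseteq> G},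
     zeroA = 0,
     addA = (+),
     mulA = (*),
     scaleA = (\<lambda>c. Poly_Mapping.map ((*) c))\<rparr>"

definition gen :: "'g \<Rightarrow> 'g word \<Rightarrow>\<^sub>0 'k::field" where
  "gen x = Poly_Mapping.single (Word [x]) 1"


section \<open>Leavitt path algebras\<close>

text \<open>A directed graph is a \<^locale>\<open>wf_digraph\<close>: \<^const>\<open>tail\<close> is the source map \<open>s\<close> and
  \<^const>\<open>head\<close> the range map \<open>r\<close>.\<close>

datatype ('v, 'e) lpa_gen = Vertex 'v | Edge 'e | Ghost 'e

definition lpa_gens :: "('v, 'e) pre_digraph \<Rightarrow> ('v, 'e) lpa_gen set" where
  "lpa_gens E = Vertex ` verts E \<union> Edge ` arcs E \<union> Ghost ` arcs E"

definition regular_verts :: "('v, 'e) pre_digraph \<Rightarrow> 'v set" where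
  "regular_verts E = {v \<in> verts E. out_arcs E v \<noteq> {} \<and> finite (out_arcs E v)}"

definition lpa_relations ::
  "('v, 'e) pre_digraph \<Rightarrow> (('v, 'e) lpa_gen word \<Rightarrow>\<^sub>0 'k::field) set" where
  "lpa_relations E =
     {gen (Vertex v) * gen (Vertex w) - (if v = w then gen (Vertex v) else 0) | v w.
        v \<in> verts E \<and> w \<in> verts E}
   \<union> {gen (Vertex (tail E e)) * gen (Edge e) - gen (Edge e) | e. e \<in> arcs E}
   \<union> {gen (Edge e) * gen (Vertex (head E e)) - gen (Edge e) | e. e \<in> arcs E}
   \<union> {gen (Vertex (head E e)) * gen (Ghost e) - gen (Ghost e) | e. e \<in> arcs E}
   \<union> {gen (Ghost e) * gen (Vertex (tail E e)) - gen (Ghost e) | e. e \<in> arcs E}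
   \<union> {gen (Ghost e) * gen (Edge f) - (if e = f then gen (Vertex (head E e)) else 0) | e f.
        e \<in> arcs E \<and> f \<in> arcs E}
   \<union> {gen (Vertex v) - (\<Sum>e\<in>out_arcs E v. gen (Edge e) * gen (Ghost e)) | v.
        v \<in> regular_verts E}"

definition leavitt_path_algebra ::
  "'k::field itself \<Rightarrow> ('v, 'e) pre_digraph \<Rightarrow>
     ('k, (('v, 'e) lpa_gen word \<Rightarrow>\<^sub>0 'k) set) algebra" where
  "leavitt_path_algebra K E =
     quotient_algebra (free_algebra (lpa_gens E))
       (algebra_ideal (free_algebra (lpa_gens E)) hull lpa_relations E)"

end

theory Submission
  imports Defs "HOL-Library.Stream"
begin

text \<open>If \<open>E\<close> has no closed walks, then modulo the relations every nonempty word in finitely many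
  generators is zero or of the form \<open>p v q\<^sup>*\<close> with walks \<open>p\<close>, \<open>q\<close>; walks in a finite acyclic
  graph repeat no edge, so only finitely many such words occur and they span a subalgebra.

  If \<open>c\<close> is a closed walk, consider the action of the generators on infinite walks.  A word of
  degree \<open>d = |c| > 0\<close> has at most one fixed point, so counting fixed points on degree \<open>d\<close> and
  taking zero in all other degrees defines a trace \<open>t\<close> on \<open>L\<^sub>K(E)\<close>.  Its kernel contains all
  commutators and is therefore a Lie ideal.  It contains the vertex \<open>v = s(c)\<close>, but not
  \<open>v c = c\<close>, since \<open>c\<close> fixes the walk \<open>ccc...\<close>; so it is not an ideal.\<close>

section \<open>Quotients of free algebras\<close>

text \<open>Scaling is rewritten as multiplication by the constant
  \<open>Poly_Mapping.single 0 c\<close>. This constant lies outside the free algebra, but in the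
  surrounding unital ring it makes the ring laws available for scalars.\<close>

lemma free_algebra_simps [simp]:
  "zeroA (free_algebra G) = 0"
  "addA (free_algebra G) = (+)"
  "mulA (free_algebra G) = (*)"
  "scaleA (free_algebra G) c p = Poly_Mapping.single 0 c * p"
  by (simp_all add: free_algebra_def mult_map_scale_conv_mult)

lemma elems_free_algebra:
  "p \<in> elems (free_algebra G) \<longleftrightarrow>
     (\<forall>w \<in> Poly_Mapping.keys p. letters w \<noteq> [] \<and> set (letters w) \<subseteq> G)"
  by (simp add: free_algebra_def)

lemma elems_free_algebra_mono: "G \<subseteq> H \<Longrightarrow> elems (free_algebra G) \<subseteq> elems (free_algebra H)"
  by (fastforce simp: elems_free_algebra)

lemma free_algebra_zero: "0 \<in> elems (free_algebra G)"
  by (simp add: elems_free_algebra)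

lemma free_algebra_add:
  "p \<in> elems (free_algebra G) \<Longrightarrow> q \<in> elems (free_algebra G) \<Longrightarrow> p + q \<in> elems (free_algebra G)"
  using Poly_Mapping.keys_add[of p q] by (auto simp: elems_free_algebra)

lemma keys_mult_cases:
  assumes "w \<in> Poly_Mapping.keys (p * q)"
  obtains u v where "u \<in> Poly_Mapping.keys p" "v \<in> Poly_Mapping.keys q" "w = u + v"
  using keys_mult[of p q] assms by auto

lemma free_algebra_mult:
  assumes "p \<in> elems (free_algebra G)" "q \<in> elems (free_algebra G)"
  shows "p * q \<in> elems (free_algebra G)"
  using assms unfolding elems_free_algebra by (fastforce elim!: keys_mult_cases simp: plus_word_def)

lemma free_algebra_scale:
  assumes "p \<in> elems (free_algebra G)"
  shows "Poly_Mapping.single 0 c * p \<in> elems (free_algebra G)"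
  using assms unfolding elems_free_algebra
  by (auto elim!: keys_mult_cases simp: plus_word_def zero_word_def split: if_splits)

lemma scale_minus_one: "Poly_Mapping.single 0 (- 1) * p = - p"
  for p :: "'g word \<Rightarrow>\<^sub>0 'k::field"
  by (simp add: single_uminus)

lemma free_algebra_uminus: "p \<in> elems (free_algebra G) \<Longrightarrow> - p \<in> elems (free_algebra G)"
  using free_algebra_scale[of p G "- 1"] by (simp add: scale_minus_one)

lemma free_algebra_diff:
  "p \<in> elems (free_algebra G) \<Longrightarrow> q \<in> elems (free_algebra G) \<Longrightarrow> p - q \<in> elems (free_algebra G)"
  using free_algebra_add[OF _ free_algebra_uminus, of p G q] by simp

lemma free_algebra_sum:
  "(\<And>i. i \<in> T \<Longrightarrow> f i \<in> elems (free_algebra G)) \<Longrightarrow> sum f T \<in> elems (free_algebra G)"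
  by (induction T rule: infinite_finite_induct) (auto intro: free_algebra_zero free_algebra_add)

lemma algebra_ideal_free_algebra: "algebra_ideal (free_algebra G) (elems (free_algebra G))"
  by (simp add: algebra_ideal_def linear_subspace_def absorbs_def free_algebra_zero
      free_algebra_add free_algebra_mult free_algebra_scale)

text \<open>The closure conditions pass to intersections. That \<open>T\<close> lies in the free
  algebra ensures that the intersection is over a nonempty family, so the hull stays inside the
  carrier.\<close>

lemma algebra_ideal_hull:
  assumes "T \<subseteq> elems (free_algebra G)"
  shows "algebra_ideal (free_algebra G) (algebra_ideal (free_algebra G) hull T)"
proof -
  let ?H = "algebra_ideal (free_algebra G) hull T"
  have "?H \<subseteq> elems (free_algebra G)"
    using assms algebra_ideal_free_algebra by (rule hull_minimal)
  then show ?thesis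
    unfolding algebra_ideal_def linear_subspace_def absorbs_def
    by (simp add: hull_def algebra_ideal_def linear_subspace_def absorbs_def)
qed

section \<open>Arithmetic in a quotient of a free algebra\<close>

locale free_quotient =
  fixes G :: "'g set" and I :: "('g word \<Rightarrow>\<^sub>0 'k::field) set"
  assumes ideal: "algebra_ideal (free_algebra G) I"
begin

abbreviation "F \<equiv> free_algebra G"
abbreviation "Q \<equiv> quotient_algebra F I"
abbreviation "\<pi> \<equiv> coset F I"

lemma ideal_elems: "I \<subseteq> elems F"
  and ideal_zero: "0 \<in> I"
  and ideal_add: "p \<in> I \<Longrightarrow> q \<in> I \<Longrightarrow> p + q \<in> I"
  and ideal_scale: "p \<in> I \<Longrightarrow> Poly_Mapping.single 0 c * p \<in> I"
  and ideal_mult_left: "p \<in> I \<Longrightarrow> a \<in> elems F \<Longrightarrow> a * p \<in> I"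
  and ideal_mult_right: "p \<in> I \<Longrightarrow> a \<in> elems F \<Longrightarrow> p * a \<in> I"
  using ideal by (auto simp: algebra_ideal_def linear_subspace_def absorbs_def)

lemma ideal_uminus: "p \<in> I \<Longrightarrow> - p \<in> I"
  using ideal_scale[of p "- 1"] by (simp add: scale_minus_one)

lemma ideal_diff: "p \<in> I \<Longrightarrow> q \<in> I \<Longrightarrow> p - q \<in> I"
  using ideal_add[OF _ ideal_uminus, of p q] by simp

lemma mem_coset_iff: "x \<in> \<pi> a \<longleftrightarrow> x - a \<in> I"
  by (auto simp: coset_def image_iff algebra_simps intro!: bexI[of _ "x - a"])

lemma coset_eq_iff: "\<pi> a = \<pi> b \<longleftrightarrow> a - b \<in> I"
proof
  assume "\<pi> a = \<pi> b"
  then show "a - b \<in> I" using ideal_zero by (metis diff_self mem_coset_iff)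
next
  assume ab: "a - b \<in> I"
  have "x - a \<in> I \<longleftrightarrow> x - b \<in> I" for x
    using ideal_add[of "x - a" "a - b"] ideal_diff[of "x - b" "a - b"] ab by auto
  then show "\<pi> a = \<pi> b" by (simp add: set_eq_iff mem_coset_iff)
qed

lemma quotient_elems: "elems Q = \<pi> ` elems F"
  and quotient_zero: "zeroA Q = \<pi> 0"
  by (simp_all add: quotient_algebra_def)

lemma coset_self: "a \<in> \<pi> a"
  by (simp add: mem_coset_iff ideal_zero)

text \<open>Quotient operations are unions of cosets over all representatives. Independence of the
  representatives makes these cosets equal, and the union collapses because cosets are
  nonempty.\<close>

lemma quotient_add: "addA Q (\<pi> a) (\<pi> b) = \<pi> (a + b)"
proof -
  have "\<pi> (x + y) = \<pi> (a + b)" if "x \<in> \<pi> a" "y \<in> \<pi> b" for x y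
    using ideal_add[of "x - a" "y - b"] that by (simp add: mem_coset_iff coset_eq_iff algebra_simps)
  then have "(\<Union>x\<in>\<pi> a. \<Union>y\<in>\<pi> b. \<pi> (x + y)) = \<pi> (a + b)"
    by (intro UN_constant_eq[OF coset_self] ballI)
  then show ?thesis by (simp add: quotient_algebra_def)
qed

lemma quotient_mul:
  assumes "a \<in> elems F" "b \<in> elems F"
  shows "mulA Q (\<pi> a) (\<pi> b) = \<pi> (a * b)"
proof -
  have "\<pi> (x * y) = \<pi> (a * b)" if "x \<in> \<pi> a" "y \<in> \<pi> b" for x y
  proof -
    have x: "x - a \<in> I" and y: "y - b \<in> I" using that by (auto simp: mem_coset_iff)
    \<comment> \<open>Absorption only concerns factors in the free algebra, so \<open>y\<close>,
      known up to an element of \<open>I\<close>, is first placed there.\<close>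
    have "y \<in> elems F" using free_algebra_add[of "y - b" G b] y assms ideal_elems by auto
    moreover have "x * y - a * b = (x - a) * y + a * (y - b)" by (simp add: algebra_simps)
    ultimately show ?thesis
      using x y assms by (simp add: coset_eq_iff ideal_add ideal_mult_left ideal_mult_right)
  qed
  then have "(\<Union>x\<in>\<pi> a. \<Union>y\<in>\<pi> b. \<pi> (x * y)) = \<pi> (a * b)"
    by (intro UN_constant_eq[OF coset_self] ballI)
  then show ?thesis by (simp add: quotient_algebra_def)
qed

lemma quotient_scale: "scaleA Q c (\<pi> a) = \<pi> (Poly_Mapping.single 0 c * a)"
proof -
  have "\<pi> (Poly_Mapping.single 0 c * x) = \<pi> (Poly_Mapping.single 0 c * a)" if "x \<in> \<pi> a" for x
    using that ideal_scale[of "x - a" c] by (simp add: mem_coset_iff coset_eq_iff algebra_simps)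
  then have "(\<Union>x\<in>\<pi> a. \<pi> (Poly_Mapping.single 0 c * x)) = \<pi> (Poly_Mapping.single 0 c * a)"
    by (intro UN_constant_eq[OF coset_self] ballI)
  then show ?thesis by (simp add: quotient_algebra_def)
qed

lemma quotient_commutator:
  assumes "a \<in> elems F" "b \<in> elems F"
  shows "commutator Q (\<pi> a) (\<pi> b) = \<pi> (a * b - b * a)"
  using assms
  by (simp add: commutator_def diffA_def quotient_mul quotient_add quotient_scale scale_minus_one)

lemma subspace_image:
  assumes "linear_subspace F U"
  shows "linear_subspace Q (\<pi> ` U)"
  using assms unfolding linear_subspace_def quotient_elems quotient_zero
  by (auto simp: quotient_add quotient_scale)

lemma subalgebra_image:
  assumes "subalgebra F U"
  shows "subalgebra Q (\<pi> ` U)"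
proof -
  have U: "linear_subspace F U" "\<And>x y. x \<in> U \<Longrightarrow> y \<in> U \<Longrightarrow> x * y \<in> U" "U \<subseteq> elems F"
    using assms by (auto simp: subalgebra_def linear_subspace_def)
  show ?thesis
    unfolding subalgebra_def using subspace_image[OF U(1)] U(2,3)
    by (auto simp: quotient_mul subset_iff)
qed

end

section \<open>Monomials and expansions in monomials\<close>

definition monomial :: "'g list \<Rightarrow> 'g word \<Rightarrow>\<^sub>0 'k::field" where
  "monomial u = Poly_Mapping.single (Word u) 1"

lemma gen_eq_monomial: "gen x = monomial [x]"
  by (simp add: gen_def monomial_def)

lemma monomial_mult: "monomial u * monomial v = monomial (u @ v)"
  by (simp add: monomial_def mult_single plus_word_def)

lemma monomial_Nil: "monomial [] = 1"
  by (metis monomial_def single_one zero_word_def)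

lemma monomial_in_free_algebra: "u \<noteq> [] \<Longrightarrow> set u \<subseteq> G \<Longrightarrow> monomial u \<in> elems (free_algebra G)"
  by (simp add: monomial_def elems_free_algebra)

lemma sum_monomials:
  "p = (\<Sum>w\<in>Poly_Mapping.keys p. Poly_Mapping.single 0 (Poly_Mapping.lookup p w) * monomial (letters w))"
proof (rule poly_mapping_eqI)
  fix k
  have "Poly_Mapping.lookup (\<Sum>w\<in>Poly_Mapping.keys p. Poly_Mapping.single w (Poly_Mapping.lookup p w)) k
      = (\<Sum>w\<in>Poly_Mapping.keys p. if w = k then Poly_Mapping.lookup p k else 0)"
    by (simp add: lookup_sum lookup_single when_def cong: if_cong)
  also have "\<dots> = Poly_Mapping.lookup p k"
    by (simp add: in_keys_iff)
  finally show "Poly_Mapping.lookup p k = Poly_Mapping.lookup (\<Sum>w\<in>Poly_Mapping.keys p. Poly_Mapping.single 0 (Poly_Mapping.lookup p w) * monomial (letters w)) k"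
    by (simp add: monomial_def mult_single)
qed

lemma linear_subspace_sum:
  assumes "linear_subspace (free_algebra G) U" "\<And>i. i \<in> T \<Longrightarrow> f i \<in> U"
  shows "sum f T \<in> U"
  using assms(2)
  by (induction T rule: infinite_finite_induct) (use assms(1) in \<open>auto simp: linear_subspace_def\<close>)


section \<open>The defining ideal of a Leavitt path algebra\<close>

definition lpa_ideal ::
  "('v, 'e) pre_digraph \<Rightarrow> (('v, 'e) lpa_gen word \<Rightarrow>\<^sub>0 'k::field) set" where
  "lpa_ideal E = algebra_ideal (free_algebra (lpa_gens E)) hull lpa_relations E"

lemma leavitt_path_algebra_eq:
  "leavitt_path_algebra TYPE('k::field) E
     = quotient_algebra (free_algebra (lpa_gens E)) (lpa_ideal E)"
  by (simp add: leavitt_path_algebra_def lpa_ideal_def)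

text \<open>Needed for the hull of the relations to be an ideal. Well-formedness of the graph puts
  sources and ranges of edges among the vertices.\<close>

lemma lpa_relations_in_free_algebra:
  assumes "wf_digraph E"
  shows "lpa_relations E \<subseteq> elems (free_algebra (lpa_gens E))"
proof -
  have gen: "gen x \<in> elems (free_algebra (lpa_gens E))" if "x \<in> lpa_gens E" for x
    using that by (simp add: gen_eq_monomial monomial_in_free_algebra)
  have V: "Vertex v \<in> lpa_gens E" if "v \<in> verts E" for v
    using that by (auto simp: lpa_gens_def)
  have A: "Edge e \<in> lpa_gens E" "Ghost e \<in> lpa_gens E"
    "Vertex (head E e) \<in> lpa_gens E" "Vertex (tail E e) \<in> lpa_gens E" if "e \<in> arcs E" for e
    using that assms by (auto simp: lpa_gens_def wf_digraph_def)
  note closed = free_algebra_diff free_algebra_mult free_algebra_zero free_algebra_sum gen V A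
  show ?thesis
    unfolding lpa_relations_def
    by (intro Un_least subsetI; elim CollectE exE conjE; hypsubst)
      (auto intro!: closed simp: regular_verts_def)
qed

section \<open>Walks and closed walks\<close>

definition walk :: "('v, 'e) pre_digraph \<Rightarrow> 'e list \<Rightarrow> bool" where
  "walk E p \<longleftrightarrow> set p \<subseteq> arcs E \<and> successively (\<lambda>e f. head E e = tail E f) p"

definition closed_walk :: "('v, 'e) pre_digraph \<Rightarrow> 'e list \<Rightarrow> bool" where
  "closed_walk E c \<longleftrightarrow> walk E c \<and> c \<noteq> [] \<and> head E (last c) = tail E (hd c)"

lemma walk_Cons:
  "walk E (e # p) \<longleftrightarrow> e \<in> arcs E \<and> walk E p \<and> (p = [] \<or> head E e = tail E (hd p))"
  by (cases p) (auto simp: walk_def)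

lemma walk_append:
  "walk E (p @ q) \<longleftrightarrow>
     walk E p \<and> walk E q \<and> (p = [] \<or> q = [] \<or> head E (last p) = tail E (hd q))"
  by (auto simp: walk_def successively_append_iff)

text \<open>The segment from one occurrence of an edge up to just before a later one is a closed
  walk, because its last edge ends where the repeated edge starts.\<close>

lemma acyclic_walk_distinct:
  assumes "\<nexists>c. closed_walk E c" "walk E p"
  shows "distinct p"
proof (rule ccontr)
  assume "\<not> distinct p"
  then obtain xs ys zs e where p: "p = xs @ [e] @ ys @ [e] @ zs"
    using not_distinct_decomp by blast
  have "walk E (xs @ (e # ys) @ ([e] @ zs))"
    using assms(2) by (simp add: p)
  then have "walk E (e # ys)" "head E (last (e # ys)) = tail E e"
    unfolding walk_append[of E xs] walk_append[of E "e # ys"] by simp_all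
  then have "closed_walk E (e # ys)" by (simp add: closed_walk_def)
  then show False using assms(1) by blast
qed

section \<open>Rewriting words modulo the defining ideal\<close>

locale leavitt = wf_digraph E for E :: "('v, 'e) pre_digraph" +
  fixes K :: "'k::field itself"
begin

abbreviation "J \<equiv> lpa_ideal E :: (('v, 'e) lpa_gen word \<Rightarrow>\<^sub>0 'k) set"

sublocale free_quotient "lpa_gens E" J
  by unfold_locales
    (simp add: lpa_ideal_def algebra_ideal_hull lpa_relations_in_free_algebra wf_digraph_axioms)

lemma Q_eq: "leavitt_path_algebra TYPE('k) E = Q"
  by (rule leavitt_path_algebra_eq)

lemma relation_in_ideal: "r \<in> lpa_relations E \<Longrightarrow> r \<in> J"
  unfolding lpa_ideal_def by (rule subsetD[OF hull_subset])

lemma gens: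
  "v \<in> verts E \<Longrightarrow> Vertex v \<in> lpa_gens E"
  "e \<in> arcs E \<Longrightarrow> Edge e \<in> lpa_gens E"
  "e \<in> arcs E \<Longrightarrow> Ghost e \<in> lpa_gens E"
  by (auto simp: lpa_gens_def)

text \<open>These are the rewriting rules from two letters to one. Read backwards, they insert the
  source or range vertex next to an edge.\<close>

lemma lpa_reductions:
  "v \<in> verts E \<Longrightarrow> monomial [Vertex v, Vertex v] - monomial [Vertex v] \<in> J"
  "e \<in> arcs E \<Longrightarrow> monomial [Vertex (tail E e), Edge e] - monomial [Edge e] \<in> J"
  "e \<in> arcs E \<Longrightarrow> monomial [Edge e, Vertex (head E e)] - monomial [Edge e] \<in> J"
  "e \<in> arcs E \<Longrightarrow> monomial [Vertex (head E e), Ghost e] - monomial [Ghost e] \<in> J"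
  "e \<in> arcs E \<Longrightarrow> monomial [Ghost e, Vertex (tail E e)] - monomial [Ghost e] \<in> J"
  "e \<in> arcs E \<Longrightarrow> monomial [Ghost e, Edge e] - monomial [Vertex (head E e)] \<in> J"
proof -
  have single: "monomial [x] = gen x" and pair: "monomial [x, y] = gen x * gen y"
    for x y :: "('v, 'e) lpa_gen"
    by (simp_all add: gen_eq_monomial monomial_mult)
  show "v \<in> verts E \<Longrightarrow> monomial [Vertex v, Vertex v] - monomial [Vertex v] \<in> J"
  proof (rule relation_in_ideal)
    assume "v \<in> verts E"
    \<comment> \<open>The trivial conditional is kept so that the term matches the set of relations
      literally.\<close>
    then have "gen (Vertex v) * gen (Vertex v) - (if v = v then gen (Vertex v) else 0)
        \<in> lpa_relations E"
      unfolding lpa_relations_def by blast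
    then show "monomial [Vertex v, Vertex v] - monomial [Vertex v] \<in> lpa_relations E"
      by (simp add: single pair)
  qed
  show "e \<in> arcs E \<Longrightarrow> monomial [Vertex (tail E e), Edge e] - monomial [Edge e] \<in> J"
    unfolding single pair by (rule relation_in_ideal) (unfold lpa_relations_def, blast)
  show "e \<in> arcs E \<Longrightarrow> monomial [Edge e, Vertex (head E e)] - monomial [Edge e] \<in> J"
    unfolding single pair by (rule relation_in_ideal) (unfold lpa_relations_def, blast)
  show "e \<in> arcs E \<Longrightarrow> monomial [Vertex (head E e), Ghost e] - monomial [Ghost e] \<in> J"
    unfolding single pair by (rule relation_in_ideal) (unfold lpa_relations_def, blast)
  show "e \<in> arcs E \<Longrightarrow> monomial [Ghost e, Vertex (tail E e)] - monomial [Ghost e] \<in> J"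
    unfolding single pair by (rule relation_in_ideal) (unfold lpa_relations_def, blast)
  show "e \<in> arcs E \<Longrightarrow> monomial [Ghost e, Edge e] - monomial [Vertex (head E e)] \<in> J"
  proof (rule relation_in_ideal)
    assume "e \<in> arcs E"
    then have "gen (Ghost e) * gen (Edge e) - (if e = e then gen (Vertex (head E e)) else 0)
        \<in> lpa_relations E"
      unfolding lpa_relations_def by blast
    then show "monomial [Ghost e, Edge e] - monomial [Vertex (head E e)] \<in> lpa_relations E"
      by (simp add: single pair)
  qed
qed

text \<open>The empty word is not in the free algebra but acts as 1, so suffixes can be attached
  without treating the empty one separately.\<close>

lemma ideal_mult_right_monomial:
  assumes "r \<in> J" "set u \<subseteq> lpa_gens E"
  shows "r * monomial u \<in> J"
  using assms by (cases "u = []") (auto simp: monomial_Nil monomial_in_free_algebra ideal_mult_right)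

text \<open>Modulo \<open>J\<close>, \<open>x = x z\<close> and \<open>z y = 0\<close> give
  \<open>x y = x z y = 0\<close>. In the applications \<open>z\<close> is a source or range
  vertex.\<close>

lemma monomial_zero_via:
  assumes "monomial [x, z] - monomial [x] \<in> J" "monomial [z, y] \<in> J"
    "x \<in> lpa_gens E" "y \<in> lpa_gens E"
  shows "monomial [x, y] \<in> J"
proof -
  have "monomial [x] * monomial [z, y] \<in> J"
    using assms by (intro ideal_mult_left monomial_in_free_algebra) auto
  moreover have "(monomial [x, z] - monomial [x]) * monomial [y] \<in> J"
    using assms by (intro ideal_mult_right monomial_in_free_algebra) auto
  ultimately have
    "monomial [x] * monomial [z, y] - (monomial [x, z] - monomial [x]) * monomial [y] \<in> J"
    by (rule ideal_diff)
  then show ?thesis by (simp add: algebra_simps monomial_mult)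
qed

text \<open>The mirror image: \<open>y = z y\<close> and \<open>x z = 0\<close> give
  \<open>x y = x z y = 0\<close>.\<close>

lemma monomial_zero_via':
  assumes "monomial [z, y] - monomial [y] \<in> J" "monomial [x, z] \<in> J"
    "x \<in> lpa_gens E" "y \<in> lpa_gens E"
  shows "monomial [x, y] \<in> J"
proof -
  have "monomial [x, z] * monomial [y] \<in> J"
    using assms by (intro ideal_mult_right monomial_in_free_algebra) auto
  moreover have "monomial [x] * (monomial [z, y] - monomial [y]) \<in> J"
    using assms by (intro ideal_mult_left monomial_in_free_algebra) auto
  ultimately have
    "monomial [x, z] * monomial [y] - monomial [x] * (monomial [z, y] - monomial [y]) \<in> J"
    by (rule ideal_diff)
  then show ?thesis by (simp add: algebra_simps monomial_mult)
qed

text \<open>Only the products of distinct vertices and the products \<open>e* f\<close> of distinct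
  edges are relations themselves. Inserting a vertex reduces vertex-edge products to the former, and
  then products of two edges or two ghost edges to vertex-edge products.\<close>

lemma lpa_vanishing:
  "v \<in> verts E \<Longrightarrow> w \<in> verts E \<Longrightarrow> v \<noteq> w \<Longrightarrow> monomial [Vertex v, Vertex w] \<in> J"
  "v \<in> verts E \<Longrightarrow> e \<in> arcs E \<Longrightarrow> v \<noteq> tail E e \<Longrightarrow> monomial [Vertex v, Edge e] \<in> J"
  "v \<in> verts E \<Longrightarrow> e \<in> arcs E \<Longrightarrow> v \<noteq> head E e \<Longrightarrow> monomial [Edge e, Vertex v] \<in> J"
  "v \<in> verts E \<Longrightarrow> e \<in> arcs E \<Longrightarrow> v \<noteq> head E e \<Longrightarrow> monomial [Vertex v, Ghost e] \<in> J"
  "v \<in> verts E \<Longrightarrow> e \<in> arcs E \<Longrightarrow> v \<noteq> tail E e \<Longrightarrow> monomial [Ghost e, Vertex v] \<in> J"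
  "e \<in> arcs E \<Longrightarrow> f \<in> arcs E \<Longrightarrow> e \<noteq> f \<Longrightarrow> monomial [Ghost e, Edge f] \<in> J"
  "e \<in> arcs E \<Longrightarrow> f \<in> arcs E \<Longrightarrow> head E e \<noteq> tail E f \<Longrightarrow> monomial [Edge e, Edge f] \<in> J"
  "e \<in> arcs E \<Longrightarrow> f \<in> arcs E \<Longrightarrow> tail E e \<noteq> head E f \<Longrightarrow> monomial [Ghost e, Ghost f] \<in> J"
proof -
  show VV: "monomial [Vertex v, Vertex w] \<in> J"
    if "v \<in> verts E" "w \<in> verts E" "v \<noteq> w" for v w
  proof (rule relation_in_ideal)
    have "monomial [Vertex v, Vertex w] =
      gen (Vertex v) * gen (Vertex w) - (if v = w then gen (Vertex v) else 0)"
      using that by (simp add: gen_eq_monomial monomial_mult)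
    then show "monomial [Vertex v, Vertex w] \<in> lpa_relations E"
      using that unfolding lpa_relations_def by blast
  qed
  show VE: "monomial [Vertex v, Edge e] \<in> J"
    if "v \<in> verts E" "e \<in> arcs E" "v \<noteq> tail E e" for v e
    using that by (auto intro!: monomial_zero_via'[OF lpa_reductions(2)] VV gens)
  show EV: "monomial [Edge e, Vertex v] \<in> J"
    if "v \<in> verts E" "e \<in> arcs E" "v \<noteq> head E e" for v e
    using that by (auto intro!: monomial_zero_via[OF lpa_reductions(3)] VV gens)
  show "monomial [Vertex v, Ghost e] \<in> J"
    if "v \<in> verts E" "e \<in> arcs E" "v \<noteq> head E e" for v e
    using that by (auto intro!: monomial_zero_via'[OF lpa_reductions(4)] VV gens)
  show GV: "monomial [Ghost e, Vertex v] \<in> J"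
    if "v \<in> verts E" "e \<in> arcs E" "v \<noteq> tail E e" for v e
    using that by (auto intro!: monomial_zero_via[OF lpa_reductions(5)] VV gens)
  show "monomial [Ghost e, Edge f] \<in> J"
    if "e \<in> arcs E" "f \<in> arcs E" "e \<noteq> f" for e f
  proof (rule relation_in_ideal)
    have "monomial [Ghost e, Edge f] =
      gen (Ghost e) * gen (Edge f) - (if e = f then gen (Vertex (head E e)) else 0)"
      using that by (simp add: gen_eq_monomial monomial_mult)
    then show "monomial [Ghost e, Edge f] \<in> lpa_relations E"
      using that unfolding lpa_relations_def by blast
  qed
  show "monomial [Edge e, Edge f] \<in> J"
    if "e \<in> arcs E" "f \<in> arcs E" "head E e \<noteq> tail E f" for e f
    using that by (auto intro!: monomial_zero_via'[OF lpa_reductions(2)] EV gens)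
  show "monomial [Ghost e, Ghost f] \<in> J"
    if "e \<in> arcs E" "f \<in> arcs E" "tail E e \<noteq> head E f" for e f
    using that by (auto intro!: monomial_zero_via'[OF lpa_reductions(4)] GV gens)
qed


section \<open>Acyclic graphs\<close>

definition normal_words :: "'v set \<Rightarrow> 'e set \<Rightarrow> ('v, 'e) lpa_gen list set" where
  "normal_words V A =
     {map Edge p @ Vertex v # map Ghost (rev q) | p v q.
        v \<in> V \<and> set p \<subseteq> A \<and> walk E p \<and> set q \<subseteq> A \<and> walk E q}"

text \<open>One normal word suffices, rather than a linear combination, because each rewriting rule
  in use replaces a word by one word or by zero.\<close>

definition reducible :: "'v set \<Rightarrow> 'e set \<Rightarrow> ('v, 'e) lpa_gen list \<Rightarrow> bool" where
  "reducible V A w \<longleftrightarrow> monomial w \<in> J \<or> (\<exists>m \<in> normal_words V A. monomial w - monomial m \<in> J)"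

lemma reducible_normal: "m \<in> normal_words V A \<Longrightarrow> reducible V A m"
  using ideal_zero by (auto simp: reducible_def intro!: bexI[of _ m])

lemma reducible_trans:
  assumes "monomial w - monomial w' \<in> J" "reducible V A w'"
  shows "reducible V A w"
  using assms(2) unfolding reducible_def
proof (elim disjE bexE)
  assume "monomial w' \<in> J"
  then show "monomial w \<in> J \<or> (\<exists>m\<in>normal_words V A. monomial w - monomial m \<in> J)"
    using ideal_add[OF assms(1), of "monomial w'"] by simp
next
  fix m assume "m \<in> normal_words V A" "monomial w' - monomial m \<in> J"
  then show "monomial w \<in> J \<or> (\<exists>m\<in>normal_words V A. monomial w - monomial m \<in> J)"
    using ideal_add[OF assms(1), of "monomial w' - monomial m"] by auto
qed

lemma reducible_rewrite:
  assumes "monomial u - monomial u' \<in> J" "set w \<subseteq> lpa_gens E" "reducible V A (u' @ w)"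
  shows "reducible V A (u @ w)"
  using reducible_trans[OF _ assms(3)] ideal_mult_right_monomial[OF assms(1,2)]
  by (simp add: algebra_simps monomial_mult)

lemma reducible_vanish:
  assumes "monomial u \<in> J" "set w \<subseteq> lpa_gens E"
  shows "reducible V A (u @ w)"
  using ideal_mult_right_monomial[OF assms] by (simp add: reducible_def monomial_mult)

context
  fixes V A
  assumes V: "V \<subseteq> verts E" and A: "A \<subseteq> arcs E" and heads: "head E ` A \<subseteq> V"
begin

text \<open>Only the first two letters of \<open>g # m\<close> can violate normality, so they
  decide: the word vanishes, a letter is absorbed or cancelled, or one of the two walks grows.
  \<open>V\<close> must contain the ranges of the edges in \<open>A\<close> because
  \<open>e* e = r(e)\<close> produces new vertices.\<close>

lemma reducible_Cons_normal:
  assumes g: "g \<in> Vertex ` V \<union> Edge ` A \<union> Ghost ` A" and m: "m \<in> normal_words V A"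
  shows "reducible V A (g # m)"
proof -
  obtain p v q where m_eq: "m = map Edge p @ Vertex v # map Ghost (rev q)"
    and v: "v \<in> V" and p: "set p \<subseteq> A" "walk E p" and q: "set q \<subseteq> A" "walk E q"
    using m by (auto simp: normal_words_def)
  have tail_gens: "set (map Ghost (rev q)) \<subseteq> lpa_gens E"
    using q A gens by auto
  have normal: "map Edge p' @ Vertex v' # map Ghost (rev q') \<in> normal_words V A"
    if "v' \<in> V" "set p' \<subseteq> A" "walk E p'" "set q' \<subseteq> A" "walk E q'" for v' p' q'
    using that by (auto simp: normal_words_def)
  have v_vert: "v \<in> verts E" using v V by blast
  \<comment> \<open>The rules are specialised to the first letters of a word, \<open>expand\<close>
    being the one that inserts a letter.\<close>
  note vanish = reducible_vanish[where u = "[x, y]" for x y, simplified]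
  note rewr = reducible_rewrite[where u = "[x, y]" and u' = "[z]" for x y z, simplified]
  note expand = reducible_rewrite[where u = "[x]" and u' = "[z, y]" for x y z, simplified]
  show ?thesis
  proof (cases p)
    case Nil
    then have m_eq: "m = Vertex v # map Ghost (rev q)" using m_eq by simp
    from g consider (V) u where "g = Vertex u" "u \<in> V" | (E) e where "g = Edge e" "e \<in> A"
      | (G) e where "g = Ghost e" "e \<in> A" by blast
    then show ?thesis
    proof cases
      case V
      then have "u \<in> verts E" using \<open>V \<subseteq> verts E\<close> by blast
      show ?thesis
      proof (cases "u = v")
        case True
        show ?thesis unfolding m_eq V True
          using reducible_normal[OF m, unfolded m_eq] tail_gens v_vert
          by - (rule rewr[OF lpa_reductions(1)]; simp)
      next
        case False
        show ?thesis unfolding m_eq V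
          using tail_gens v_vert \<open>u \<in> verts E\<close> False
          by (intro vanish lpa_vanishing(1)) auto
      qed
    next
      case E
      then have e: "e \<in> arcs E" using A by blast
      show ?thesis
      proof (cases "v = head E e")
        case True
        have "reducible V A (map Edge [e] @ Vertex v # map Ghost (rev q))"
          using E q e v by (intro reducible_normal normal) (auto simp: walk_Cons walk_def)
        then show ?thesis unfolding m_eq E by simp
      next
        case False
        then show ?thesis unfolding m_eq E
          using tail_gens v_vert e by (intro vanish lpa_vanishing(3)) auto
      qed
    next
      case G
      then have e: "e \<in> arcs E" using A by blast
      have he: "head E e \<in> V" using heads G by blast
      show ?thesis
      proof (cases "v = tail E e")
        case True
        have "reducible V A (Ghost e # map Ghost (rev q))"
        proof (cases "q = [] \<or> tail E e = head E (last q)")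
          case True
          \<comment> \<open>After \<open>e* = r(e) e*\<close> the word is normal. Ghost edges are
            listed in reverse, so \<open>e\<close> is appended at the end of
            \<open>q\<close>.\<close>
          have "reducible V A (map Edge [] @ Vertex (head E e) # map Ghost (rev (q @ [e])))"
            using G q e he True
            by (intro reducible_normal normal) (auto simp: walk_append walk_Cons walk_def[of E "[]"])
          then have "reducible V A (Vertex (head E e) # Ghost e # map Ghost (rev q))"
            by simp
          moreover have "monomial [Ghost e] - monomial [Vertex (head E e), Ghost e] \<in> J"
            using ideal_uminus[OF lpa_reductions(4)[OF e]] by simp
          ultimately show ?thesis using tail_gens by (rule expand[rotated 2])
        next
          case False
          \<comment> \<open>The last edge \<open>f\<close> of \<open>q\<close> gives the first ghost
            letter, and \<open>e* f*\<close> vanishes because \<open>f\<close> does not end where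
            \<open>e\<close> starts.\<close>
          then obtain q' f where qf: "q = q' @ [f]" by (cases q rule: rev_cases) auto
          then show ?thesis using False tail_gens e q A unfolding qf
            by (simp del: set_map) (intro vanish lpa_vanishing(8); auto)
        qed
        then show ?thesis unfolding m_eq G True
          using tail_gens e by - (rule rewr[OF lpa_reductions(5)]; simp)
      next
        case False
        then show ?thesis unfolding m_eq G
          using tail_gens v_vert e by (intro vanish lpa_vanishing(5)) auto
      qed
    qed
  next
    case (Cons f p')
    let ?w = "map Edge p' @ Vertex v # map Ghost (rev q)"
    have m_eq: "m = Edge f # ?w" using m_eq Cons by simp
    have f: "f \<in> A" "f \<in> arcs E" and p': "set p' \<subseteq> A" "walk E p'"
      using p A unfolding Cons by (auto simp: walk_Cons)
    have w: "set ?w \<subseteq> lpa_gens E"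
      using p' A gens v_vert tail_gens by auto
    have w_normal: "reducible V A ?w"
      using p' q v by (intro reducible_normal normal)
    from g consider (V) u where "g = Vertex u" "u \<in> V" | (E) e where "g = Edge e" "e \<in> A"
      | (G) e where "g = Ghost e" "e \<in> A" by blast
    then show ?thesis
    proof cases
      case V
      then have u: "u \<in> verts E" using \<open>V \<subseteq> verts E\<close> by blast
      show ?thesis
      proof (cases "u = tail E f")
        case True
        show ?thesis unfolding m_eq V True
          using reducible_normal[OF m, unfolded m_eq] w f
          by - (rule rewr[OF lpa_reductions(2)]; simp)
      next
        case False
        show ?thesis unfolding m_eq V
          using w u f False by (intro vanish lpa_vanishing(2)) auto
      qed
    next
      case E
      then have e: "e \<in> arcs E" using A by blast
      show ?thesis
      proof (cases "head E e = tail E f")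
        case True
        have "reducible V A (map Edge (e # p) @ Vertex v # map Ghost (rev q))"
          using E q e v p True Cons by (intro reducible_normal normal) (auto simp: walk_Cons)
        then show ?thesis unfolding m_eq E Cons by simp
      next
        case False
        then show ?thesis unfolding m_eq E
          using w f e by (intro vanish lpa_vanishing(7)) auto
      qed
    next
      case G
      then have e: "e \<in> arcs E" using A by blast
      have he: "head E e \<in> verts E" using e by simp
      show ?thesis
      proof (cases "e = f")
        case True
        \<comment> \<open>After \<open>e* e = r(e)\<close> this vertex stands before the remaining
          word. The next edge of \<open>p'\<close> absorbs it; if there is none, it meets
          \<open>v\<close>, and the word vanishes unless \<open>v = r(e)\<close>.\<close>
        have "reducible V A (Vertex (head E e) # ?w)"
        proof (cases p')
          case Nil
          have n: "reducible V A (Vertex v # map Ghost (rev q))" using w_normal Nil by simp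
          show ?thesis
          proof (cases "head E e = v")
            case True
            then show ?thesis using n Nil tail_gens v_vert
              by - (simp, rule rewr[OF lpa_reductions(1)]; simp)
          next
            case False
            then show ?thesis using Nil tail_gens v_vert he
              by - (simp, rule vanish, rule lpa_vanishing(1); simp)
          qed
        next
          case (Cons f' p'')
          then have "head E e = tail E f'" "f' \<in> arcs E"
            using p \<open>p = f # p'\<close> True A by (auto simp: walk_Cons)
          then show ?thesis using w_normal w unfolding Cons
            by - (simp, rule rewr[OF lpa_reductions(2)]; simp)
        qed
        then show ?thesis unfolding m_eq G True
          using w f True by - (rule rewr[OF lpa_reductions(6)]; simp)
      next
        case False
        then show ?thesis unfolding m_eq G
          using w f e by (intro vanish lpa_vanishing(6)) auto
      qed
    qed
  qed
qed

text \<open>Letters are prepended one at a time to the normal form of the rest. A single edge or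
  ghost edge becomes normal through \<open>e = e r(e)\<close> or
  \<open>e* = r(e) e*\<close>.\<close>

lemma reducible_word:
  assumes "w \<noteq> []" "set w \<subseteq> Vertex ` V \<union> Edge ` A \<union> Ghost ` A"
  shows "reducible V A w"
  using assms
proof (induction w)
  case (Cons g w)
  then have g: "g \<in> Vertex ` V \<union> Edge ` A \<union> Ghost ` A" by simp
  then have g_gen: "g \<in> lpa_gens E" using V A gens by blast
  show ?case
  proof (cases "w = []")
    case True
    have W: "walk E []" by (simp add: walk_def)
    from g consider (V) u where "g = Vertex u" "u \<in> V" | (E) e where "g = Edge e" "e \<in> A"
      | (G) e where "g = Ghost e" "e \<in> A" by blast
    then show ?thesis
    proof cases
      case V
      then have "[Vertex u] \<in> normal_words V A"
        using W by (force simp: normal_words_def)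
      then show ?thesis unfolding True V by (rule reducible_normal)
    next
      case E
      then have e: "e \<in> arcs E" "head E e \<in> V" using A heads by auto
      have "[Vertex (head E e)] \<in> normal_words V A"
        using W e by (force simp: normal_words_def)
      then have "reducible V A [Edge e, Vertex (head E e)]"
        using E by (intro reducible_Cons_normal) auto
      moreover have "monomial [Edge e] - monomial [Edge e, Vertex (head E e)] \<in> J"
        using ideal_uminus[OF lpa_reductions(3)[OF e(1)]] by simp
      ultimately show ?thesis unfolding True E by (rule reducible_trans[rotated])
    next
      case G
      then have e: "e \<in> arcs E" "head E e \<in> V" using A heads by auto
      have "walk E [e]" using e by (simp add: walk_def)
      have "map Edge [] @ Vertex (head E e) # map Ghost (rev [e]) \<in> normal_words V A"
        unfolding normal_words_def using W e G \<open>walk E [e]\<close> by fastforce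
      then have "reducible V A [Vertex (head E e), Ghost e]"
        by (intro reducible_normal) simp
      moreover have "monomial [Ghost e] - monomial [Vertex (head E e), Ghost e] \<in> J"
        using ideal_uminus[OF lpa_reductions(4)[OF e(1)]] by simp
      ultimately show ?thesis unfolding True G by (rule reducible_trans[rotated])
    qed
  next
    case False
    with Cons have "reducible V A w" by simp
    then show ?thesis
      unfolding reducible_def[of V A w]
    proof (elim disjE bexE)
      assume "monomial w \<in> J"
      then have "monomial [g] * monomial w \<in> J"
        using g_gen by (intro ideal_mult_left monomial_in_free_algebra) auto
      then show ?thesis by (simp add: reducible_def monomial_mult)
    next
      fix m assume m: "m \<in> normal_words V A" "monomial w - monomial m \<in> J"
      then have "monomial [g] * (monomial w - monomial m) \<in> J"
        using g_gen by (intro ideal_mult_left monomial_in_free_algebra) auto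
      then have "monomial (g # w) - monomial (g # m) \<in> J"
        by (simp add: algebra_simps monomial_mult)
      then show ?thesis using reducible_Cons_normal[OF g m(1)] by (rule reducible_trans)
    qed
  qed
qed simp

end

section \<open>Finite-dimensional subalgebras in the acyclic case\<close>

lemma finite_normal_words:
  assumes "\<nexists>c. closed_walk E c" "finite V" "finite A"
  shows "finite (normal_words V A)"
proof -
  let ?P = "{p. set p \<subseteq> A \<and> distinct p}"
  have "finite ?P" using assms(3) by (rule finite_subset_distinct)
  let ?f = "\<lambda>(p, v, q). map Edge p @ Vertex v # map Ghost (rev q)"
  have "normal_words V A \<subseteq> ?f ` (?P \<times> V \<times> ?P)"
  proof
    fix m assume "m \<in> normal_words V A"
    then obtain p v q where "m = ?f (p, v, q)" "(p, v, q) \<in> ?P \<times> V \<times> ?P"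
      using acyclic_walk_distinct[OF assms(1)] unfolding normal_words_def by auto
    then show "m \<in> ?f ` (?P \<times> V \<times> ?P)" by (rule image_eqI)
  qed
  moreover have "finite (?f ` (?P \<times> V \<times> ?P))"
    using \<open>finite ?P\<close> assms(2) by simp
  ultimately show ?thesis by (rule finite_subset)
qed

text \<open>The classes of all words over \<open>G0\<close> span. Although there may be infinitely
  many words, each class is zero or the class of a normal word, so the spanning set is
  finite.\<close>

lemma finite_dimensional_subalgebra:
  assumes "\<nexists>c. closed_walk E c" "finite V" "finite A"
    and V: "V \<subseteq> verts E" and A: "A \<subseteq> arcs E" and heads: "head E ` A \<subseteq> V"
  defines "G0 \<equiv> Vertex ` V \<union> Edge ` A \<union> Ghost ` A"
  shows "finite_dimensional Q (\<pi> ` elems (free_algebra G0))"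
proof -
  let ?B = "\<pi> ` elems (free_algebra G0)"
  define T where "T = {\<pi> (monomial w) | w. w \<noteq> [] \<and> set w \<subseteq> G0}"
  have G0: "G0 \<subseteq> lpa_gens E" using V A gens by (auto simp: G0_def)
  have "T \<subseteq> insert (\<pi> 0) ((\<lambda>m. \<pi> (monomial m)) ` normal_words V A)"
  proof
    fix x assume "x \<in> T"
    then obtain w where w: "x = \<pi> (monomial w)" "w \<noteq> []" "set w \<subseteq> G0" by (auto simp: T_def)
    have "reducible V A w" using reducible_word[OF V A heads] w by (simp add: G0_def)
    then show "x \<in> insert (\<pi> 0) ((\<lambda>m. \<pi> (monomial m)) ` normal_words V A)"
      unfolding reducible_def w(1) using coset_eq_iff by auto
  qed
  then have "finite T"
    using finite_normal_words[OF assms(1-3)] by (meson finite_imageI finite_insert finite_subset)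
  have B_sub: "?B \<subseteq> elems Q"
    using elems_free_algebra_mono[OF G0] by (auto simp: quotient_elems)
  have TB: "T \<subseteq> ?B" by (auto simp: T_def intro!: imageI monomial_in_free_algebra)
  have "linear_subspace F (elems (free_algebra G0))"
    using elems_free_algebra_mono[OF G0]
    by (auto simp: linear_subspace_def free_algebra_zero free_algebra_add free_algebra_scale)
  then have B: "linear_subspace Q ?B" by (rule subspace_image)
  have min: "?B \<subseteq> U" if U: "linear_subspace Q U" "T \<subseteq> U" for U
  proof -
    \<comment> \<open>Minimality is pulled back to the free algebra: the preimage of
      \<open>U\<close> is a subspace that contains all words over \<open>G0\<close>, hence all their
      linear combinations.\<close>
    let ?U = "{p \<in> elems F. \<pi> p \<in> U}"
    have scale: "\<pi> (Poly_Mapping.single 0 c * p) \<in> U" if "\<pi> p \<in> U" for c p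
      using U(1) that unfolding linear_subspace_def by (metis quotient_scale)
    have add: "\<pi> (p + q) \<in> U" if "\<pi> p \<in> U" "\<pi> q \<in> U" for p q
      using U(1) that unfolding linear_subspace_def by (metis quotient_add)
    have "\<pi> 0 \<in> U" using U(1) by (simp add: linear_subspace_def quotient_zero)
    then have sub: "linear_subspace F ?U"
      by (auto simp: linear_subspace_def free_algebra_zero free_algebra_add free_algebra_scale scale add)
    have "(\<Sum>w\<in>Poly_Mapping.keys p. Poly_Mapping.single 0 (Poly_Mapping.lookup p w) *
        monomial (letters w)) \<in> ?U" if p: "p \<in> elems (free_algebra G0)" for p
    proof (rule linear_subspace_sum[OF sub])
      fix w assume "w \<in> Poly_Mapping.keys p"
      then have w: "letters w \<noteq> []" "set (letters w) \<subseteq> G0" using p by (auto simp: elems_free_algebra)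
      then have "\<pi> (monomial (letters w)) \<in> U" using U(2) by (auto simp: T_def)
      then show "Poly_Mapping.single 0 (Poly_Mapping.lookup p w) * monomial (letters w) \<in> ?U"
        using w G0 by (auto intro!: scale free_algebra_scale monomial_in_free_algebra)
    qed
    then show ?thesis unfolding sum_monomials[symmetric] by auto
  qed
  have "linear_span Q T = ?B"
    unfolding linear_span_def
  proof (rule subset_antisym)
    show "linear_subspace Q hull T \<subseteq> ?B" using TB B by (rule hull_minimal)
    show "?B \<subseteq> linear_subspace Q hull T"
      unfolding hull_def using min by (intro Inter_greatest) blast
  qed
  then show ?thesis
    unfolding finite_dimensional_def
    using \<open>finite T\<close> subset_trans[OF TB B_sub] by (intro exI[of _ T] conjI)
qed

lemma acyclic_imp_locally_finite:
  assumes "\<nexists>c. closed_walk E c"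
  shows "locally_finite Q"
  unfolding locally_finite_def
proof (intro allI impI, elim conjE)
  fix S assume "finite S" "S \<subseteq> elems Q"
  then obtain R where R: "finite R" "R \<subseteq> elems F" "S = \<pi> ` R"
    unfolding quotient_elems by (meson finite_subset_image)
  \<comment> \<open>\<open>H\<close> collects the letters of the representatives. Edges are taken
    whether they occur plain or as ghosts, and their ranges are added to \<open>V\<close> as the
    reduction to normal words requires.\<close>
  define H where "H = (\<Union>p\<in>R. \<Union>w\<in>Poly_Mapping.keys p. set (letters w))"
  define A where "A = {e. Edge e \<in> H \<or> Ghost e \<in> H}"
  define V where "V = {v. Vertex v \<in> H} \<union> head E ` A"
  let ?G0 = "Vertex ` V \<union> Edge ` A \<union> Ghost ` A"
  have "finite H" using R(1) by (auto simp: H_def)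
  have H: "H \<subseteq> lpa_gens E" using R(2) by (fastforce simp: H_def elems_free_algebra)
  have "A = Edge -` H \<union> Ghost -` H" by (auto simp: A_def)
  then have finA: "finite A"
    using \<open>finite H\<close> by (auto intro!: finite_vimageI simp: inj_on_def)
  have "{v. Vertex v \<in> H} = Vertex -` H" by auto
  then have finV: "finite V"
    using \<open>finite H\<close> finA by (auto intro!: finite_vimageI simp: inj_on_def V_def)
  have A: "A \<subseteq> arcs E" using H by (auto simp: A_def lpa_gens_def)
  have V: "V \<subseteq> verts E" using H A by (auto simp: V_def lpa_gens_def)
  have fd: "finite_dimensional Q (\<pi> ` elems (free_algebra ?G0))"
    using V_def by (intro finite_dimensional_subalgebra assms finV finA V A) auto
  have "?G0 \<subseteq> lpa_gens E" using V A gens by auto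
  then have "elems (free_algebra ?G0) \<subseteq> elems F" by (rule elems_free_algebra_mono)
  then have "subalgebra F (elems (free_algebra ?G0))"
    by (simp add: subalgebra_def linear_subspace_def free_algebra_zero free_algebra_add
        free_algebra_scale free_algebra_mult)
  then have sub: "subalgebra Q (\<pi> ` elems (free_algebra ?G0))" by (rule subalgebra_image)
  have "H \<subseteq> ?G0"
  proof
    fix x assume "x \<in> H"
    then show "x \<in> ?G0" by (cases x) (auto simp: A_def V_def)
  qed
  have "R \<subseteq> elems (free_algebra ?G0)"
  proof
    fix p assume "p \<in> R"
    then have "p \<in> elems F" "\<And>w. w \<in> Poly_Mapping.keys p \<Longrightarrow> set (letters w) \<subseteq> H"
      using R(2) by (auto simp: H_def)
    then show "p \<in> elems (free_algebra ?G0)"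
      unfolding elems_free_algebra using \<open>H \<subseteq> ?G0\<close> by (meson order_trans)
  qed
  then have "S \<subseteq> \<pi> ` elems (free_algebra ?G0)" using R(3) by blast
  with sub fd show "\<exists>B. subalgebra Q B \<and> finite_dimensional Q B \<and> S \<subseteq> B"
    by (intro exI conjI)
qed

end


section \<open>Traces on free algebras\<close>

definition linear_extension :: "('g word \<Rightarrow> 'k) \<Rightarrow> ('g word \<Rightarrow>\<^sub>0 'k) \<Rightarrow> 'k::field" where
  "linear_extension \<tau> p = (\<Sum>w\<in>Poly_Mapping.keys p. Poly_Mapping.lookup p w * \<tau> w)"

text \<open>Allows polynomials with different supports to be summed over one common finite
  set.\<close>

lemma linear_extension_superset:
  assumes "finite S" "Poly_Mapping.keys p \<subseteq> S"
  shows "linear_extension \<tau> p = (\<Sum>w\<in>S. Poly_Mapping.lookup p w * \<tau> w)"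
  unfolding linear_extension_def using assms
  by (intro sum.mono_neutral_left) (auto simp: in_keys_iff)

lemma linear_extension_add:
  "linear_extension \<tau> (p + q) = linear_extension \<tau> p + linear_extension \<tau> q"
proof -
  let ?S = "Poly_Mapping.keys p \<union> Poly_Mapping.keys q"
  have "linear_extension \<tau> r = (\<Sum>w\<in>?S. Poly_Mapping.lookup r w * \<tau> w)"
    if "Poly_Mapping.keys r \<subseteq> ?S" for r
    using that by (intro linear_extension_superset) auto
  from this[of p] this[of q] this[of "p + q"] show ?thesis
    by (simp add: Poly_Mapping.keys_add lookup_add distrib_right sum.distrib)
qed

lemma linear_extension_single: "linear_extension \<tau> (Poly_Mapping.single w c) = c * \<tau> w"
  by (simp add: linear_extension_superset[of "{w}"])

lemma linear_extension_monomial: "linear_extension \<tau> (monomial u) = \<tau> (Word u)"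
  by (simp add: monomial_def linear_extension_single)

lemma linear_extension_zero: "linear_extension \<tau> 0 = 0"
  by (simp add: linear_extension_def)

lemma linear_extension_sum:
  "linear_extension \<tau> (sum f T) = (\<Sum>i\<in>T. linear_extension \<tau> (f i))"
  by (induction T rule: infinite_finite_induct)
    (simp_all add: linear_extension_zero linear_extension_add)

lemma linear_extension_uminus: "linear_extension \<tau> (- p) = - linear_extension \<tau> p"
  using linear_extension_add[of \<tau> p "- p"] by (simp add: linear_extension_zero eq_neg_iff_add_eq_0 add.commute)

lemma linear_extension_diff:
  "linear_extension \<tau> (p - q) = linear_extension \<tau> p - linear_extension \<tau> q"
  using linear_extension_add[of \<tau> p "- q"] by (simp add: linear_extension_uminus)

lemma sum_single: "p = (\<Sum>w\<in>Poly_Mapping.keys p. Poly_Mapping.single w (Poly_Mapping.lookup p w))"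
  for p :: "'g word \<Rightarrow>\<^sub>0 'k::field"
  using sum_monomials[of p] by (simp add: monomial_def mult_single)

lemma linear_extension_mult:
  "linear_extension \<tau> (p * q) = (\<Sum>u\<in>Poly_Mapping.keys p. \<Sum>v\<in>Poly_Mapping.keys q.
     Poly_Mapping.lookup p u * Poly_Mapping.lookup q v * \<tau> (u + v))"
proof -
  have "p * q = (\<Sum>u\<in>Poly_Mapping.keys p. \<Sum>v\<in>Poly_Mapping.keys q.
     Poly_Mapping.single (u + v) (Poly_Mapping.lookup p u * Poly_Mapping.lookup q v))"
    by (subst (1) sum_single[of p], subst (1) sum_single[of q]) (simp add: sum_product mult_single)
  then show ?thesis by (simp add: linear_extension_sum linear_extension_single)
qed

lemma linear_extension_scale:
  "linear_extension \<tau> (Poly_Mapping.single 0 c * p) = c * linear_extension \<tau> p"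
proof -
  have "Poly_Mapping.lookup (Poly_Mapping.single 0 c * p) w = c * Poly_Mapping.lookup p w" for w
    by (simp flip: mult_map_scale_conv_mult add: Poly_Mapping.map.rep_eq when_def)
  then show ?thesis
    by (subst linear_extension_superset[of "Poly_Mapping.keys p"])
      (auto simp: linear_extension_def sum_distrib_left mult.assoc in_keys_iff)
qed

lemma linear_extension_trace:
  assumes "\<And>u v. \<tau> (u + v) = \<tau> (v + u)"
  shows "linear_extension \<tau> (p * q) = linear_extension \<tau> (q * p)"
  unfolding linear_extension_mult
  by (subst sum.swap) (simp add: assms mult.commute[of "Poly_Mapping.lookup p _"])

lemma linear_extension_mult_left:
  assumes "\<And>u. linear_extension \<tau> (monomial u * p) = 0"
  shows "linear_extension \<tau> (a * p) = 0"
proof -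
  have "linear_extension \<tau> (\<Sum>w\<in>Poly_Mapping.keys a.
      Poly_Mapping.single 0 (Poly_Mapping.lookup a w) * (monomial (letters w) * p)) = 0"
    unfolding linear_extension_sum by (simp add: linear_extension_scale assms)
  moreover have "a * p = (\<Sum>w\<in>Poly_Mapping.keys a.
      Poly_Mapping.single 0 (Poly_Mapping.lookup a w) * (monomial (letters w) * p))"
    by (subst sum_monomials[of a]) (simp add: sum_distrib_right mult.assoc)
  ultimately show ?thesis by simp
qed

text \<open>The radical of the trace form is a two-sided ideal, so a trace kills the ideal generated by
  \<open>R\<close> as soon as the radical contains \<open>R\<close>; this only has to be tested against words on one side.\<close>

lemma trace_vanishes_on_hull:
  assumes trace: "\<And>u v. \<tau> (u + v) = \<tau> (v + u)"
    and R: "R \<subseteq> elems (free_algebra G)"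
    and vanish: "\<And>r u. r \<in> R \<Longrightarrow> linear_extension \<tau> (monomial u * r) = 0"
    and p: "p \<in> algebra_ideal (free_algebra G) hull R"
  shows "linear_extension \<tau> p = 0"
proof -
  let ?N = "{p \<in> elems (free_algebra G). \<forall>a. linear_extension \<tau> (a * p) = 0}"
  \<comment> \<open>The trace property turns \<open>a p b\<close> into \<open>b a p\<close>, where
    the right factor \<open>b\<close> has become a left factor.\<close>
  have right: "linear_extension \<tau> (a * (p * b)) = 0"
    if "\<forall>a. linear_extension \<tau> (a * p) = 0" for a b p
    using that linear_extension_trace[of \<tau>, OF trace, of "a * p" b] by (simp add: mult.assoc[symmetric])
  have left: "linear_extension \<tau> (a * (b * p)) = 0"
    if "\<forall>a. linear_extension \<tau> (a * p) = 0" for a b p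
    using that by (simp add: mult.assoc[symmetric])
  have "algebra_ideal (free_algebra G) ?N"
    unfolding algebra_ideal_def linear_subspace_def absorbs_def
    by (simp add: free_algebra_zero free_algebra_add free_algebra_mult free_algebra_scale
        linear_extension_zero linear_extension_add distrib_left left right)
  moreover have "R \<subseteq> ?N"
    using R linear_extension_mult_left[OF vanish] by auto
  \<comment> \<open>In the definition of the radical \<open>a\<close> ranges over the whole unital
    ring, so \<open>a = 1\<close> gives the value at \<open>p\<close> itself.\<close>
  ultimately have "linear_extension \<tau> (1 * p) = 0"
    using hull_minimal[of R ?N] p by blast
  then show ?thesis by simp
qed


section \<open>Graphs with closed walks\<close>

definition infinite_walk :: "('v, 'e) pre_digraph \<Rightarrow> 'e stream \<Rightarrow> bool" where
  "infinite_walk E \<xi> \<longleftrightarrow> (\<forall>n. \<xi> !! n \<in> arcs E \<and> head E (\<xi> !! n) = tail E (\<xi> !! Suc n))"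

text \<open>An infinite walk from \<open>v\<close> has exactly one first edge, so the sets fixed by
  the \<open>e e*\<close> with \<open>s(e) = v\<close> partition the set fixed by \<open>v\<close>.
  This is what the relation at a regular vertex requires.\<close>

definition infinite_walks_from :: "('v, 'e) pre_digraph \<Rightarrow> 'v \<Rightarrow> 'e stream set" where
  "infinite_walks_from E v = {\<xi>. infinite_walk E \<xi> \<and> tail E (shd \<xi>) = v}"

text \<open>The generators act on infinite walks by partial injections; a pair consists of the image and
  the argument, so that words act by relational composition in the same order.\<close>

fun gen_action :: "('v, 'e) pre_digraph \<Rightarrow> ('v, 'e) lpa_gen \<Rightarrow> 'e stream rel" where
  "gen_action E (Vertex v) = Id_on (infinite_walks_from E v)"
| "gen_action E (Edge e) = {(e ## \<xi>, \<xi>) | \<xi>. \<xi> \<in> infinite_walks_from E (head E e)}"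
| "gen_action E (Ghost e) = {(\<xi>, e ## \<xi>) | \<xi>. \<xi> \<in> infinite_walks_from E (head E e)}"

fun action :: "('v, 'e) pre_digraph \<Rightarrow> ('v, 'e) lpa_gen list \<Rightarrow> 'e stream rel" where
  "action E [] = Id"
| "action E (g # w) = gen_action E g O action E w"

text \<open>The standard integer grading, for which all defining relations are homogeneous.\<close>

fun gen_degree :: "('v, 'e) lpa_gen \<Rightarrow> int" where
  "gen_degree (Vertex v) = 0"
| "gen_degree (Edge e) = 1"
| "gen_degree (Ghost e) = - 1"

abbreviation degree :: "('v, 'e) lpa_gen list \<Rightarrow> int" where
  "degree w \<equiv> sum_list (map gen_degree w)"

section \<open>The action of words on infinite walks\<close>

lemma infinite_walk_SCons:
  "infinite_walk E (e ## \<xi>) \<longleftrightarrow> e \<in> arcs E \<and> \<xi> \<in> infinite_walks_from E (head E e)"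
proof -
  have "(\<forall>n. P n) \<longleftrightarrow> P 0 \<and> (\<forall>n. P (Suc n))" for P :: "nat \<Rightarrow> bool"
    by (metis not0_implies_Suc)
  from this[of "\<lambda>n. (e ## \<xi>) !! n \<in> arcs E \<and> head E ((e ## \<xi>) !! n) = tail E ((e ## \<xi>) !! Suc n)"]
  show ?thesis by (auto simp: infinite_walk_def infinite_walks_from_def)
qed

lemma infinite_walks_from_SCons:
  "e ## \<xi> \<in> infinite_walks_from E v \<longleftrightarrow>
     e \<in> arcs E \<and> tail E e = v \<and> \<xi> \<in> infinite_walks_from E (head E e)"
  by (auto simp: infinite_walks_from_def[of E v] infinite_walk_SCons)

lemma action_append: "action E (u @ v) = action E u O action E v"
  by (induction u) (auto simp: O_assoc)

text \<open>Every word acts as a restriction, possibly empty, of a single exchange of the prefix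
  \<open>q\<close> for \<open>p\<close>. Prepending an edge lengthens \<open>p\<close>; prepending a
  ghost edge removes the first edge of \<open>p\<close> or, if \<open>p\<close> is empty, lengthens
  \<open>q\<close> at its end.\<close>

lemma action_prefix_form:
  "\<exists>p q. int (length p) - int (length q) = degree w \<and>
     (\<forall>\<zeta> \<xi>. (\<zeta>, \<xi>) \<in> action E w \<longrightarrow> (\<exists>\<eta>. \<zeta> = p @- \<eta> \<and> \<xi> = q @- \<eta>))"
proof (induction w)
  case Nil
  show ?case by (intro exI[of _ "[]"]) auto
next
  case (Cons g w)
  then obtain p q where len: "int (length p) - int (length q) = degree w"
    and pq: "\<And>\<zeta> \<xi>. (\<zeta>, \<xi>) \<in> action E w \<Longrightarrow> \<exists>\<eta>. \<zeta> = p @- \<eta> \<and> \<xi> = q @- \<eta>" by blast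
  show ?case
  proof (cases g)
    case (Vertex v)
    then show ?thesis using len pq by (intro exI[of _ p] exI[of _ q]) auto
  next
    case (Edge e)
    then show ?thesis using len pq by (intro exI[of _ "e # p"] exI[of _ q]) fastforce
  next
    case (Ghost e)
    show ?thesis
    proof (cases p)
      case Nil
      have "\<exists>\<eta>. \<zeta> = [] @- \<eta> \<and> \<xi> = (q @ [e]) @- \<eta>" if "(\<zeta>, \<xi>) \<in> action E (g # w)" for \<zeta> \<xi>
        using that Ghost pq[of "e ## \<zeta>" \<xi>] Nil by auto
      then show ?thesis using len Ghost Nil
        by (intro exI[of _ "[]"] exI[of _ "q @ [e]"]) auto
    next
      case (Cons f p')
      have "\<exists>\<eta>. \<zeta> = p' @- \<eta> \<and> \<xi> = q @- \<eta>" if "(\<zeta>, \<xi>) \<in> action E (g # w)" for \<zeta> \<xi>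
        using that Ghost pq[of "e ## \<zeta>" \<xi>] Cons by auto
      then show ?thesis using len Ghost Cons
        by (intro exI[of _ p'] exI[of _ q]) auto
    qed
  qed
qed

text \<open>The only solution is \<open>r r r ...\<close>: beyond the first \<open>length r\<close>
  entries, entry \<open>n\<close> equals entry \<open>n - length r\<close>, an earlier one because
  \<open>r\<close> is nonempty.\<close>

lemma shift_fixpoint_unique:
  assumes "r \<noteq> []" "\<eta> = r @- \<eta>" "\<theta> = r @- \<theta>"
  shows "\<eta> = \<theta>"
proof -
  have "\<eta> !! n = \<theta> !! n" for n
  proof (induction n rule: less_induct)
    case (less n)
    have "n < length r \<or> n - length r < n" using assms(1) by (cases r) auto
    then show ?case
      using less[of "n - length r"] assms(2,3) by (metis shift_snth)
  qed
  then have "smap (snth \<eta>) nats = smap (snth \<theta>) nats" by (metis ext)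
  then show ?thesis by (simp add: stream_smap_nats[symmetric])
qed

text \<open>A fixed point has the form \<open>p \<eta> = q \<eta>\<close> with \<open>p\<close>
  longer than \<open>q\<close>. Dropping \<open>length q\<close> entries gives
  \<open>\<eta> = r \<eta>\<close> for a nonempty end piece \<open>r\<close> of \<open>p\<close>,
  which determines \<open>\<eta>\<close>.\<close>

lemma action_fixpoint_unique:
  assumes "degree w > 0" "(\<xi>, \<xi>) \<in> action E w" "(\<zeta>, \<zeta>) \<in> action E w"
  shows "\<xi> = \<zeta>"
proof -
  obtain p q where len: "int (length p) - int (length q) = degree w"
    and pq: "\<And>\<zeta> \<xi>. (\<zeta>, \<xi>) \<in> action E w \<Longrightarrow> \<exists>\<eta>. \<zeta> = p @- \<eta> \<and> \<xi> = q @- \<eta>"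
    using action_prefix_form[of w E] by blast
  have less: "length q < length p" using len assms(1) by linarith
  have drop: "\<eta> = drop (length q) p @- \<eta>" if "p @- \<eta> = q @- \<eta>" for \<eta>
    using arg_cong[OF that, of "sdrop (length q)"] less by (simp add: sdrop_shift)
  obtain \<eta> \<theta> where "\<xi> = p @- \<eta>" "\<xi> = q @- \<eta>" "\<zeta> = p @- \<theta>" "\<zeta> = q @- \<theta>"
    using pq[OF assms(2)] pq[OF assms(3)] by blast
  moreover have "drop (length q) p \<noteq> []" using less by simp
  ultimately show ?thesis
    using shift_fixpoint_unique[of "drop (length q) p" \<eta> \<theta>] drop[of \<eta>] drop[of \<theta>] by simp
qed

text \<open>For \<open>d > 0\<close> a word of degree \<open>d\<close> has at most one fixed point,
  so the number of fixed points is an indicator and is not lost in any characteristic.\<close>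

definition fixpoint_count ::
  "('v, 'e) pre_digraph \<Rightarrow> int \<Rightarrow> ('v, 'e) lpa_gen word \<Rightarrow> 'k::field" where
  "fixpoint_count E d w =
     of_bool (degree (letters w) = d \<and> (\<exists>\<xi>. (\<xi>, \<xi>) \<in> action E (letters w)))"

text \<open>If \<open>u v\<close> fixes an infinite walk, then \<open>v u\<close> fixes the
  intermediate walk, and conversely.\<close>

lemma fixpoint_count_commute:
  fixes E :: "('a, 'b) pre_digraph"
  shows "fixpoint_count E d (u + v) = fixpoint_count E d (v + u)"
proof -
  have "(\<exists>\<xi>. (\<xi>, \<xi>) \<in> R O S) \<longleftrightarrow> (\<exists>\<xi>. (\<xi>, \<xi>) \<in> S O R)" for R S :: "'b stream rel" by blast
  from this[of "action E (letters u)" "action E (letters v)"] show ?thesis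
    by (simp add: fixpoint_count_def plus_word_def action_append add.commute)
qed

lemma fixpoint_count_rotate:
  "fixpoint_count E d (Word (u @ v)) = fixpoint_count E d (Word (v @ u))"
  using fixpoint_count_commute[of E d "Word u" "Word v"] by (simp add: plus_word_def)

lemma fixpoint_count_cong:
  assumes "degree v = degree w" "action E v = action E w"
  shows "fixpoint_count E d (Word (u @ v)) = fixpoint_count E d (Word (u @ w))"
  by (simp add: fixpoint_count_def action_append assms)

lemma fixpoint_count_empty:
  assumes "action E v = {}"
  shows "fixpoint_count E d (Word (u @ v)) = 0"
  by (simp add: fixpoint_count_def action_append assms)

text \<open>Rotation turns the left side into the existence of a fixed point of \<open>u\<close>
  starting at \<open>v\<close>, and each summand into that of one with first edge \<open>e\<close>.
  Uniqueness for \<open>d > 0\<close> makes at most one summand nonzero, so the indicators add up.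
  Finiteness matters because a sum over an infinite set is 0 by default.\<close>

lemma fixpoint_count_vertex:
  assumes "d > 0" "finite (out_arcs E v)"
  shows "fixpoint_count E d (Word (u @ [Vertex v])) =
    (\<Sum>e\<in>out_arcs E v. fixpoint_count E d (Word (u @ [Edge e, Ghost e])) :: 'k::field)"
proof -
  have V: "fixpoint_count E d (Word (u @ [Vertex v])) =
      (of_bool (degree u = d \<and> (\<exists>\<xi>\<in>infinite_walks_from E v. (\<xi>, \<xi>) \<in> action E u)) :: 'k)"
    unfolding fixpoint_count_rotate[of E d u] by (auto simp: fixpoint_count_def)
  have EG: "fixpoint_count E d (Word (u @ [Edge e, Ghost e])) =
      (of_bool (degree u = d \<and> (\<exists>\<xi>\<in>infinite_walks_from E v. shd \<xi> = e \<and> (\<xi>, \<xi>) \<in> action E u)) :: 'k)"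
    if "e \<in> out_arcs E v" for e
  proof -
    have "(\<exists>\<xi>. (\<xi>, \<xi>) \<in> action E ([Edge e, Ghost e] @ u)) \<longleftrightarrow>
        (\<exists>\<eta>\<in>infinite_walks_from E (head E e). (e ## \<eta>, e ## \<eta>) \<in> action E u)"
      by auto
    also have "\<dots> \<longleftrightarrow> (\<exists>\<xi>\<in>infinite_walks_from E v. shd \<xi> = e \<and> (\<xi>, \<xi>) \<in> action E u)"
      using that by (metis infinite_walks_from_SCons in_out_arcs_conv stream.collapse stream.sel(1))
    finally show ?thesis
      unfolding fixpoint_count_rotate[of E d u] by (simp add: fixpoint_count_def)
  qed
  show ?thesis
  proof (cases "degree u = d \<and> (\<exists>\<xi>\<in>infinite_walks_from E v. (\<xi>, \<xi>) \<in> action E u)")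
    case False
    then show ?thesis unfolding V by (auto simp: EG)
  next
    case True
    then obtain \<xi> where \<xi>: "\<xi> \<in> infinite_walks_from E v" "(\<xi>, \<xi>) \<in> action E u"
      and deg: "degree u = d" by blast
    have unique: "\<zeta> = \<xi>" if "(\<zeta>, \<zeta>) \<in> action E u" for \<zeta>
      using action_fixpoint_unique[of u \<zeta> E \<xi>] that \<xi> deg assms(1) by simp
    have "shd \<xi> ## stl \<xi> \<in> infinite_walks_from E v" using \<xi>(1) by simp
    then have "shd \<xi> \<in> out_arcs E v"
      unfolding infinite_walks_from_SCons in_out_arcs_conv by (elim conjE) (intro conjI)
    moreover have "fixpoint_count E d (Word (u @ [Edge e, Ghost e])) = (of_bool (e = shd \<xi>) :: 'k)"
      if "e \<in> out_arcs E v" for e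
    proof -
      have "(\<exists>\<zeta>\<in>infinite_walks_from E v. shd \<zeta> = e \<and> (\<zeta>, \<zeta>) \<in> action E u) \<longleftrightarrow> e = shd \<xi>"
        using \<xi> unique by blast
      then show ?thesis unfolding EG[OF that] using deg by simp
    qed
    ultimately show ?thesis
      unfolding V using True assms(2) by (simp add: of_bool_def)
  qed
qed

text \<open>All relations except those at regular vertices hold already for the partial injections;
  those involve a sum and are handled by \<open>fixpoint_count_vertex\<close>.\<close>

lemma action_relations:
  "action E [Vertex v, Vertex v] = action E [Vertex v]"
  "v \<noteq> w \<Longrightarrow> action E [Vertex v, Vertex w] = {}"
  "e \<in> arcs E \<Longrightarrow> action E [Vertex (tail E e), Edge e] = action E [Edge e]"
  "action E [Edge e, Vertex (head E e)] = action E [Edge e]"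
  "action E [Vertex (head E e), Ghost e] = action E [Ghost e]"
  "e \<in> arcs E \<Longrightarrow> action E [Ghost e, Vertex (tail E e)] = action E [Ghost e]"
  "action E [Ghost e, Edge e] = action E [Vertex (head E e)]"
  "e \<noteq> f \<Longrightarrow> action E [Ghost e, Edge f] = {}"
  by (auto simp: infinite_walks_from_SCons relcomp_unfold) (auto simp: infinite_walks_from_def)

text \<open>By \<open>trace_vanishes_on_hull\<close> it suffices to test each relation after a word
  \<open>u\<close>. The two sides then have equal degree and action, or the action is empty, or
  \<open>fixpoint_count_vertex\<close> applies.\<close>

lemma fixpoint_trace_vanishes:
  assumes "wf_digraph E" "d > 0" "p \<in> lpa_ideal E"
  shows "linear_extension (fixpoint_count E d) p = (0 :: 'k::field)"
proof (rule trace_vanishes_on_hull[of "fixpoint_count E d", OF fixpoint_count_commute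
      lpa_relations_in_free_algebra[OF assms(1)]])
  show "p \<in> algebra_ideal (free_algebra (lpa_gens E)) hull lpa_relations E"
    using assms(3) by (simp add: lpa_ideal_def)
  fix r :: "('a, 'b) lpa_gen word \<Rightarrow>\<^sub>0 'k" and u assume r: "r \<in> lpa_relations E"
  note expand = linear_extension_diff linear_extension_sum linear_extension_monomial
    gen_eq_monomial monomial_mult right_diff_distrib sum_distrib_left
  have equal: "linear_extension (fixpoint_count E d) (monomial u * (gen x * gen y - gen z)) = (0::'k)"
    if "degree [x, y] = degree [z]" "action E [x, y] = action E [z]" for x y z
    using fixpoint_count_cong[OF that] by (simp add: expand)
  have zero: "linear_extension (fixpoint_count E d) (monomial u * (gen x * gen y - 0)) = (0::'k)"
    if "action E [x, y] = {}" for x y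
    using fixpoint_count_empty[OF that] by (simp add: expand)
  have ck2: "linear_extension (fixpoint_count E d) (monomial u *
      (gen (Vertex v) - (\<Sum>e\<in>out_arcs E v. gen (Edge e) * gen (Ghost e)))) = (0::'k)"
    if "v \<in> regular_verts E" for v
    using that fixpoint_count_vertex[OF assms(2), of E v u, where 'k = 'k]
    by (simp add: expand regular_verts_def)
  have vv: "linear_extension (fixpoint_count E d) (monomial u *
      (gen (Vertex v) * gen (Vertex w) - (if v = w then gen (Vertex v) else 0))) = (0::'k)" for v w
    using equal[OF _ action_relations(1)[of E v]] zero[OF action_relations(2)[of v w E]]
    by (cases "v = w") simp_all
  have ge: "linear_extension (fixpoint_count E d) (monomial u *
      (gen (Ghost e) * gen (Edge f) - (if e = f then gen (Vertex (head E e)) else 0))) = (0::'k)" for e f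
    using equal[OF _ action_relations(7)[of E e]] zero[OF action_relations(8)[of e f E]]
    by (cases "e = f") simp_all
  note eqs = equal[OF _ action_relations(3)] equal[OF _ action_relations(4)]
    equal[OF _ action_relations(5)] equal[OF _ action_relations(6)]
  from r consider
      v w where "r = gen (Vertex v) * gen (Vertex w) - (if v = w then gen (Vertex v) else 0)"
    | e where "e \<in> arcs E" "r = gen (Vertex (tail E e)) * gen (Edge e) - gen (Edge e)"
    | e where "r = gen (Edge e) * gen (Vertex (head E e)) - gen (Edge e)"
    | e where "r = gen (Vertex (head E e)) * gen (Ghost e) - gen (Ghost e)"
    | e where "e \<in> arcs E" "r = gen (Ghost e) * gen (Vertex (tail E e)) - gen (Ghost e)"
    | e f where "r = gen (Ghost e) * gen (Edge f) - (if e = f then gen (Vertex (head E e)) else 0)"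
    | v where "v \<in> regular_verts E"
        "r = gen (Vertex v) - (\<Sum>e\<in>out_arcs E v. gen (Edge e) * gen (Ghost e))"
    unfolding lpa_relations_def by blast
  then show "linear_extension (fixpoint_count E d) (monomial u * r) = 0"
    by cases (simp_all only: vv ge ck2 eqs gen_degree.simps list.map sum_list.Cons sum_list.Nil
        add_0_left add_0_right)
qed

section \<open>A closed walk yields a Lie ideal that is not an ideal\<close>

lemma infinite_walk_cycle:
  assumes "closed_walk E c"
  shows "infinite_walk E (cycle c)"
  unfolding infinite_walk_def
proof (intro allI)
  fix n
  have c: "c \<noteq> []" "set c \<subseteq> arcs E" "head E (last c) = tail E (hd c)"
    "\<And>i. Suc i < length c \<Longrightarrow> head E (c ! i) = tail E (c ! Suc i)"
    using assms by (auto simp: closed_walk_def walk_def successively_conv_nth)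
  have nth: "cycle c !! n = c ! (n mod length c)" for n
  proof -
    have "cycle c !! n = shd (sdrop n (cycle c))" by simp
    also have "\<dots> = hd (rotate (n mod length c) c)" unfolding sdrop_cycle[OF c(1)] by simp
    also have "\<dots> = c ! (n mod length c)" using c(1) by (simp add: hd_rotate_conv_nth)
    finally show ?thesis .
  qed
  have lt: "n mod length c < length c" using c(1) by simp
  show "cycle c !! n \<in> arcs E \<and> head E (cycle c !! n) = tail E (cycle c !! Suc n)"
  \<comment> \<open>At the end of a period the closing condition
    \<open>head E (last c) = tail E (hd c)\<close> is used, elsewhere the walk condition inside
    \<open>c\<close>.\<close>
  proof (cases "Suc (n mod length c) = length c")
    case True
    then have "n mod length c = length c - 1" by linarith
    then have "c ! (n mod length c) = last c" by (simp only: last_conv_nth[OF c(1)])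
    moreover have "c ! (Suc n mod length c) = hd c" using True c(1) by (simp add: mod_Suc hd_conv_nth)
    ultimately show ?thesis using c(1-3) by (simp add: nth last_in_set subsetD del: snth.simps)
  next
    case False
    then have "Suc (n mod length c) < length c" using lt by simp
    moreover have "Suc n mod length c = Suc (n mod length c)" using False by (simp add: mod_Suc)
    moreover have "c ! (n mod length c) \<in> arcs E" using c(2) lt nth_mem by blast
    ultimately show ?thesis using c(4)[of "n mod length c"] by (simp add: nth del: snth.simps)
  qed
qed

lemma action_edges:
  assumes "infinite_walk E (p @- \<xi>)"
  shows "(p @- \<xi>, \<xi>) \<in> action E (map Edge p)"
  using assms
proof (induction p)
  case (Cons e p)
  then have "p @- \<xi> \<in> infinite_walks_from E (head E e)" by (simp add: infinite_walk_SCons)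
  moreover from this have "(p @- \<xi>, \<xi>) \<in> action E (map Edge p)"
    using Cons.IH by (simp add: infinite_walks_from_def)
  ultimately show ?case by auto
qed simp

lemma (in leavitt) closed_walk_imp_lie_ideal_not_ideal:
  assumes c: "closed_walk E c"
  obtains U where "lie_ideal Q U" "\<not> ring_ideal Q U"
proof
  define d where "d = int (length c)"
  define t :: "(('v, 'e) lpa_gen word \<Rightarrow>\<^sub>0 'k) \<Rightarrow> 'k"
    where "t = linear_extension (fixpoint_count E d)"
  let ?U = "\<pi> ` {p \<in> elems F. t p = 0}"
  have c_ne: "c \<noteq> []" and c_arcs: "set c \<subseteq> arcs E"
    using c by (auto simp: closed_walk_def walk_def)
  then have "d > 0" by (simp add: d_def)
  have t_ideal: "t p = 0" if "p \<in> J" for p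
    using fixpoint_trace_vanishes[OF wf_digraph_axioms \<open>d > 0\<close> that] by (simp add: t_def)
  have "linear_subspace F {p \<in> elems F. t p = 0}"
    by (simp add: linear_subspace_def t_def free_algebra_zero free_algebra_add free_algebra_scale
        linear_extension_zero linear_extension_add linear_extension_scale)
  then have "linear_subspace Q ?U" by (rule subspace_image)
  \<comment> \<open>Here \<open>p\<close> need not lie in the kernel of \<open>t\<close>: the trace
    vanishes on all commutators.\<close>
  moreover have "commutator Q (\<pi> p) (\<pi> q) \<in> ?U" if "p \<in> elems F" "q \<in> elems F" for p q
  proof -
    have "t (p * q - q * p) = 0"
      using linear_extension_trace[of "fixpoint_count E d", OF fixpoint_count_commute]
      by (simp add: t_def linear_extension_diff)
    then show ?thesis using that
      by (simp add: quotient_commutator free_algebra_diff free_algebra_mult)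
  qed
  ultimately show "lie_ideal Q ?U" by (auto simp: lie_ideal_def quotient_elems)
  let ?v = "tail E (hd c)"
  let ?m = "monomial [Vertex ?v] :: ('v, 'e) lpa_gen word \<Rightarrow>\<^sub>0 'k"
  let ?c = "monomial (map Edge c) :: ('v, 'e) lpa_gen word \<Rightarrow>\<^sub>0 'k"
  show "\<not> ring_ideal Q ?U"
  proof
    assume ideal: "ring_ideal Q ?U"
    have hd: "hd c \<in> arcs E" using c_ne c_arcs by auto
    have m: "?m \<in> elems F" using hd by (intro monomial_in_free_algebra) (auto intro: gens)
    have c': "?c \<in> elems F"
      using c_ne c_arcs by (intro monomial_in_free_algebra) (auto intro: gens)
    \<comment> \<open>The vertex does fix infinite walks, but its degree is 0 and not
      \<open>d\<close>.\<close>
    have "t ?m = 0"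
      using \<open>d > 0\<close> by (simp add: t_def linear_extension_monomial fixpoint_count_def)
    then have "mulA Q (\<pi> ?m) (\<pi> ?c) \<in> ?U"
      using ideal m c' by (auto simp: ring_ideal_def absorbs_def quotient_elems)
    \<comment> \<open>The product is known to be represented in the kernel only up to
      \<open>J\<close>; as \<open>t\<close> vanishes on \<open>J\<close>, this representative and
      \<open>?m * ?c\<close> have the same trace.\<close>
    then obtain q where "t q = 0" "\<pi> (?m * ?c) = \<pi> q"
      using m c' by (auto simp: quotient_mul)
    then have "t (?m * ?c) = 0"
      using t_ideal[of "?m * ?c - q"] by (simp add: coset_eq_iff t_def linear_extension_diff)
    moreover have "t (?m * ?c) = 1"
    proof -
      have walk: "infinite_walk E (cycle c)" using c by (rule infinite_walk_cycle)
      have "(cycle c, cycle c) \<in> action E (map Edge c)"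
        using action_edges[of E c "cycle c"] walk cycle_decomp[OF c_ne] by simp
      moreover have "cycle c \<in> infinite_walks_from E ?v"
        using walk by (simp add: infinite_walks_from_def)
      ultimately have "(cycle c, cycle c) \<in> action E (Vertex ?v # map Edge c)" by auto
      moreover have "degree (Vertex ?v # map Edge c) = d"
        by (simp add: d_def comp_def sum_list_triv)
      ultimately show ?thesis
        by (auto simp: t_def monomial_mult linear_extension_monomial fixpoint_count_def
            simp del: action.simps)
    qed
    ultimately show False by simp
  qed
qed

text \<open>Both algebras have the same subspaces and spans, and a subspace closed under products is
  closed under commutators. Hence the same finite-dimensional \<open>B\<close> serves for
  both.\<close>

lemma locally_finite_lie_algebra_of:
  assumes "locally_finite A"
  shows "locally_finite (lie_algebra_of A)"
proof -
  have [simp]: "elems (lie_algebra_of A) = elems A" "mulA (lie_algebra_of A) = commutator A"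
    "linear_subspace (lie_algebra_of A) = linear_subspace A"
    by (simp_all add: lie_algebra_of_def linear_subspace_def fun_eq_iff)
  then have fd: "finite_dimensional (lie_algebra_of A) = finite_dimensional A"
    by (simp add: finite_dimensional_def linear_span_def fun_eq_iff)
  have "subalgebra (lie_algebra_of A) B" if "subalgebra A B" for B
    using that by (simp add: subalgebra_def linear_subspace_def commutator_def diffA_def)
  then show ?thesis using assms unfolding locally_finite_def fd by simp blast
qed

theorem corollary4p5:
  fixes E :: "('v, 'e) pre_digraph"
  assumes "wf_digraph E"
    and "\<And>U. lie_ideal (leavitt_path_algebra TYPE('k::field) E) U \<Longrightarrow>
               ring_ideal (leavitt_path_algebra TYPE('k) E) U"
  shows "locally_finite (leavitt_path_algebra TYPE('k) E)
       \<and> locally_finite (lie_algebra_of (leavitt_path_algebra TYPE('k) E))"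
proof -
  interpret leavitt E "TYPE('k)" using assms(1) by (simp add: leavitt_def)
  have "\<nexists>c. closed_walk E c"
    using closed_walk_imp_lie_ideal_not_ideal assms(2) unfolding Q_eq by metis
  then have "locally_finite (leavitt_path_algebra TYPE('k) E)"
    unfolding Q_eq by (rule acyclic_imp_locally_finite)
  then show ?thesis by (simp add: locally_finite_lie_algebra_of)
qed

end
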